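(* Let $\{\mathbf{X}_n=(X_{n,1},\dots,X_{n,d})\}_{n\ge1}$ be the $d$-variate sequence defined by $X_{n,j}=\max(c_jX_{n-1,j},\,Y_{n,j})$, $n\ge1$, $j=1,\dots,d$, with $0<c_j<1$, where $\mathbf{X}_0=(X_{0,1},\dots,X_{0,d})$ and $\mathbf{Y}_n=(Y_{n,1},\dots,Y_{n,d})$, $n\ge1$, are independent, $\mathbf{X}_0\sim F_0$ and $\mathbf{Y}_n\sim G$. Then $\{\mathbf{X}_n\}_{n\ge1}$ is a stationary sequence with common non-degenerate distribution if and only if there exists $(x_1,\dots,x_d)\in\mathbb{R}_+^d$ such that $$0<\sum_{i=1}^{\infty}-\log G\Big(\frac{x_1}{c_1^{i}},\dots,\frac{x_d}{c_d^{i}}\Big)<\infty .$$ In this case, the common distribution $F$ of $\{\mathbf{X}_n\}_{n\ge1}$ satisfies $$F(x_1,\dots,x_d)=F\Big(\frac{x_1}{c_1},\dots,\frac{x_d}{c_d}\Big)G(x_1,\dots,x_d).$$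
   Context: $F_0$ and $G$ are distribution functions on $\mathbb{R}^d$: $F_0$ is the distribution of the initial vector $\mathbf{X}_0$ and $G$ is the common distribution of the innovations $\mathbf{Y}_n$. $\mathbb{R}_+^d$ denotes the set of vectors in $\mathbb{R}^d$ with positive components. A distribution function $F$ on $\mathbb{R}^d$ is non-degenerate if there exists $\mathbf{x}=(x_1,\dots,x_d)$ such that $0<F(x_1,\dots,x_d)<1$.
   Formalization: For a given F_0 the "if" direction is false (d=1, c=1/2, G uniform on [0,1], X_0=10); the equivalence is proved for the existence of some F_0 making {X_n} stationary, while "only if" and the equation for F hold for every F_0. *)

theory Defs
  imports "HOL-Probability.Probability"
begin

text \<open>The order on \<^typ>\<open>real^'d\<close> is componentwise, so \<open>{..x}\<close> is the lower orthant
  \<open>{y. \<forall>j. y $ j \<le> x $ j}\<close>.\<close>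

definition joint_cdf :: "(real^'d) measure \<Rightarrow> real^'d \<Rightarrow> real" where
  "joint_cdf \<mu> x = measure \<mu> {..x}"

definition distribution_function :: "(real^'d \<Rightarrow> real) \<Rightarrow> bool" where
  "distribution_function F \<longleftrightarrow>
     (\<exists>\<mu>. prob_space \<mu> \<and> sets \<mu> = sets borel \<and> F = joint_cdf \<mu>)"

definition nondegenerate :: "(real^'d \<Rightarrow> real) \<Rightarrow> bool" where
  "nondegenerate F \<longleftrightarrow> (\<exists>x. 0 < F x \<and> F x < 1)"

definition has_df :: "'a measure \<Rightarrow> ('a \<Rightarrow> real^'d) \<Rightarrow> (real^'d \<Rightarrow> real) \<Rightarrow> bool" where
  "has_df M X F \<longleftrightarrow> X \<in> borel_measurable M \<and> joint_cdf (distr M borel X) = F"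

text \<open>Strict stationarity: all finite-dimensional distributions are shift invariant.\<close>

definition stationary :: "'a measure \<Rightarrow> (nat \<Rightarrow> 'a \<Rightarrow> real^'d) \<Rightarrow> bool" where
  "stationary M Z \<longleftrightarrow>
     (\<forall>n. Z n \<in> borel_measurable M) \<and>
     (\<forall>I h. finite I \<longrightarrow>
        distr M (Pi\<^sub>M I (\<lambda>_. borel)) (\<lambda>\<omega>. \<lambda>i\<in>I. Z i \<omega>) =
        distr M (Pi\<^sub>M I (\<lambda>_. borel)) (\<lambda>\<omega>. \<lambda>i\<in>I. Z (i + h) \<omega>))"

text \<open>The innovations are \<open>Y 1, Y 2, \<dots>\<close>; the value \<open>Y 0\<close> is never used.\<close>

locale max_ar = prob_space M
  for M :: "'a measure" +
  fixes c :: "real^'d"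
    and F0 G :: "real^'d \<Rightarrow> real"
    and X Y :: "nat \<Rightarrow> 'a \<Rightarrow> real^'d"
  assumes indep: "indep_vars (\<lambda>_. borel) (\<lambda>n. if n = 0 then X 0 else Y n) UNIV"
    and initial: "has_df M (X 0) F0"
    and innovations: "\<And>n. n \<ge> 1 \<Longrightarrow> has_df M (Y n) G"
    and recursion: "\<And>n j \<omega>. n \<ge> 1 \<Longrightarrow> \<omega> \<in> space M \<Longrightarrow>
          X n \<omega> $ j = max (c $ j * X (n - 1) \<omega> $ j) (Y n \<omega> $ j)"

text \<open>Stationarity concerns the sequence \<open>X 1, X 2, \<dots>\<close> only. The law \<open>F0\<close> of \<open>X 0\<close> need not
  be the common distribution \<open>F\<close>. No condition on \<open>c\<close> and \<open>G\<close> alone makes the sequence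
  stationary for every \<open>F0\<close>, so that they admit a stationary sequence is a claim about the
  existence of an \<open>F0\<close>. As HOL cannot quantify over types within a formula, this existence is
  stated on the sample space \<open>nat \<Rightarrow> real^'d\<close>, which carries \<open>(X 0, Y 1, Y 2, \<dots>)\<close> for all
  laws \<open>F0\<close> and \<open>G\<close>; what holds for every stationary sequence is stated on any type.\<close>

definition stationary_max_ar ::
  "'a measure \<Rightarrow> real^'d \<Rightarrow> (real^'d \<Rightarrow> real) \<Rightarrow> (real^'d \<Rightarrow> real) \<Rightarrow>
   (nat \<Rightarrow> 'a \<Rightarrow> real^'d) \<Rightarrow> (nat \<Rightarrow> 'a \<Rightarrow> real^'d) \<Rightarrow> (real^'d \<Rightarrow> real) \<Rightarrow> bool" where
  "stationary_max_ar M c F0 G X Y F \<longleftrightarrow>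
     max_ar M c F0 G X Y \<and> stationary M (\<lambda>n. X (Suc n)) \<and>
     (\<forall>n\<ge>1. has_df M (X n) F) \<and> nondegenerate F"

text \<open>\<open>-log p\<close> for \<open>0 \<le> p \<le> 1\<close> with the convention \<open>-log 0 = \<infinity>\<close>, which HOL's \<open>ln 0 = 0\<close>
  does not respect.\<close>

definition neg_log :: "real \<Rightarrow> ennreal" where
  "neg_log p = (if p = 0 then \<infinity> else ennreal (- ln p))"

definition scaled :: "real^'d \<Rightarrow> nat \<Rightarrow> real^'d \<Rightarrow> real^'d" where
  "scaled c i x = (\<chi> j. x $ j / c $ j ^ i)"

definition summability_condition :: "real^'d \<Rightarrow> (real^'d \<Rightarrow> real) \<Rightarrow> bool" where
  "summability_condition c G \<longleftrightarrow>
     (\<exists>x. (\<forall>j. 0 < x $ j) \<and>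
        0 < (\<Sum>i. neg_log (G (scaled c (Suc i) x))) \<and>
        (\<Sum>i. neg_log (G (scaled c (Suc i) x))) < \<infinity>)"

end

theory Submission
  imports Defs "HOL-Real_Asymp.Real_Asymp"
begin

text \<open>
  Write \<open>x/c\<^sup>i\<close> for \<open>scaled c i x\<close>. One step of the recursion gives
  \<open>X (n + 1) \<le> x \<longleftrightarrow> X n \<le> x/c \<and> Y (n + 1) \<le> x\<close>. As \<open>X n\<close> and \<open>Y (n + 1)\<close> are independent, a common
  distribution function \<open>F\<close> of the states satisfies \<open>F x = F (x/c) * G x\<close> (\<open>df_X_Suc\<close>).

  This equation carries both directions. For positive \<open>x\<close> the points \<open>x/c\<^sup>i\<close> increase to infinity,
  so iterating it gives \<open>F (x/c) = (\<Prod>i\<ge>1. G (x/c\<^sup>i))\<close>; the series in question is therefore \<open>-log F (x/c)\<close>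
  (\<open>suminf_neg_log_df\<close>), and it lies strictly between 0 and infinity exactly if \<open>0 < F (x/c) < 1\<close>.
  Since \<open>F\<close> vanishes at every point with a negative coordinate and is continuous from the right, it
  takes a value strictly between 0 and 1 somewhere exactly if it does so at a positive point. Hence, for
  every solution \<open>F\<close> of the equation, the summability condition is equivalent to non-degeneracy of
  \<open>F\<close> (\<open>summability_condition_iff_nondegenerate\<close>).

  It remains to construct, from the summability condition, a stationary process. Its one-dimensional law
  is that of \<open>sup\<^sub>i c\<^sup>i Z\<^sub>i\<close> for i.i.d. \<open>Z\<^sub>i\<close> with distribution function \<open>G\<close>. Finiteness of the
  series makes this supremum finite almost surely, by Borel--Cantelli (\<open>AE_discounted_bdd\<close>), and adding
  one more innovation in front of the sequence shows that its law is invariant under the recursion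
  (\<open>distr_discounted_sup\<close>). Started from an invariant law, the process is strictly stationary, because
  the state and the future innovations at any time have the same joint law
  (\<open>stationary_if_distr_X_1_eq_X_0\<close>).
\<close>

section \<open>Coordinates and scaling\<close>

lemma borel_measurable_vec_nth [measurable]: "(\<lambda>x::real^'d. x $ j) \<in> borel_measurable borel"
  by (intro borel_measurable_continuous_onI continuous_intros)

lemma borel_measurable_vec_lambda:
  fixes f :: "'a \<Rightarrow> 'd::finite \<Rightarrow> real"
  assumes [measurable]: "\<And>j. (\<lambda>\<omega>. f \<omega> j) \<in> borel_measurable M"
  shows "(\<lambda>\<omega>. \<chi> j. f \<omega> j) \<in> borel_measurable M"
  by (subst borel_measurable_euclidean_space) (auto simp: Basis_vec_def inner_axis)

lemma scaled_nth [simp]: "scaled c i x $ j = x $ j / c $ j ^ i"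
  by (simp add: scaled_def)

lemma scaled_0 [simp]: "scaled c 0 x = x"
  by (simp add: vec_eq_iff)

lemma scaled_scaled: "scaled c i (scaled c k x) = scaled c (i + k) x"
  by (simp add: vec_eq_iff power_add mult.commute)

section \<open>The recursion as a function of its inputs\<close>

definition max_step :: "real^'d \<Rightarrow> real^'d \<Rightarrow> real^'d \<Rightarrow> real^'d" where
  "max_step c z y = (\<chi> j. max (c $ j * z $ j) (y $ j))"

lemma measurable_max_step [measurable]:
  assumes [measurable]: "f \<in> borel_measurable M" "g \<in> borel_measurable M"
  shows "(\<lambda>\<omega>. max_step c (f \<omega>) (g \<omega>)) \<in> borel_measurable M"
  unfolding max_step_def
  by (intro borel_measurable_vec_lambda) measurable

text \<open>The identity behind the functional equation: an orthant pulls back under one step of the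
  recursion to a product of orthants.\<close>

lemma max_step_le_iff:
  fixes c :: "real^'d"
  assumes "\<And>j. 0 < c $ j"
  shows "max_step c z y \<le> x \<longleftrightarrow> z \<le> scaled c 1 x \<and> y \<le> x"
  using assms by (auto simp: less_eq_vec_def max_step_def pos_le_divide_eq mult.commute)

text \<open>The recursion as a deterministic function of its inputs, the starting point \<open>w 0\<close> and
  the innovations \<open>w 1, w 2, \<dots>\<close>, so that laws of inputs determine laws of paths.\<close>

primrec max_path :: "real^'d \<Rightarrow> (nat \<Rightarrow> real^'d) \<Rightarrow> nat \<Rightarrow> real^'d" where
  "max_path c w 0 = w 0"
| "max_path c w (Suc n) = max_step c (max_path c w n) (w (Suc n))"

text \<open>The reason why a state is independent of the later innovations: it is a function of the
  inputs up to its own time.\<close>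

lemma max_path_cong: "(\<And>i. i \<le> n \<Longrightarrow> w i = v i) \<Longrightarrow> max_path c w n = max_path c v n"
  by (induction n) auto

lemma measurable_max_path:
  fixes c :: "real^'d"
  assumes "{..n} \<subseteq> I"
  shows "(\<lambda>w. max_path c w n) \<in> borel_measurable (Pi\<^sub>M I (\<lambda>_. borel))"
  using assms
proof (induction n)
  case (Suc n)
  then have [measurable]: "(\<lambda>w. max_path c w n) \<in> borel_measurable (Pi\<^sub>M I (\<lambda>_. borel))"
    by (auto simp: subset_iff)
  have "(\<lambda>w. w (Suc n)) \<in> borel_measurable (Pi\<^sub>M I (\<lambda>_. borel :: (real^'d) measure))"
    using Suc.prems by (intro measurable_component_singleton) auto
  then show ?case by simp
qed (auto intro: measurable_component_singleton)

section \<open>Independence and one-step laws of the process\<close>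

context max_ar
begin

text \<open>The inputs of the process restarted at time \<open>h\<close>, with the current state as the new starting
  point.\<close>

definition inputs_from :: "nat \<Rightarrow> nat \<Rightarrow> 'a \<Rightarrow> real^'d" where
  "inputs_from h n = (if n = 0 then X h else Y (n + h))"

lemma X_Suc: "\<omega> \<in> space M \<Longrightarrow> X (Suc n) \<omega> = max_step c (X n \<omega>) (Y (Suc n) \<omega>)"
  using recursion[of "Suc n" \<omega>] by (simp add: vec_eq_iff max_step_def)

lemma X_eq_max_path:
  assumes "\<omega> \<in> space M"
  shows "X (n + h) \<omega> = max_path c (\<lambda>i. inputs_from h i \<omega>) n"
  by (induction n) (use assms in \<open>simp_all add: inputs_from_def X_Suc\<close>)

lemma indep_inputs_0: "indep_vars (\<lambda>_. borel) (inputs_from 0) UNIV"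
proof -
  have "inputs_from 0 = (\<lambda>n. if n = 0 then X 0 else Y n)"
    by (simp add: inputs_from_def fun_eq_iff)
  then show ?thesis using indep by simp
qed

lemma measurable_Y: "n \<ge> 1 \<Longrightarrow> Y n \<in> borel_measurable M"
  using innovations by (auto simp: has_df_def)

lemma measurable_X [measurable]: "X n \<in> borel_measurable M"
proof (induction n)
  case 0
  show ?case using initial by (simp add: has_df_def)
next
  case (Suc n)
  have [measurable]: "Y (Suc n) \<in> borel_measurable M" by (rule measurable_Y) simp
  have "(\<lambda>\<omega>. max_step c (X n \<omega>) (Y (Suc n) \<omega>)) \<in> borel_measurable M"
    using Suc by measurable
  then show ?case by (subst measurable_cong[OF X_Suc])
qed

text \<open>The restarted inputs are functions of disjoint blocks of the original ones: the state
  \<open>X h\<close> uses the block \<open>{..h}\<close>, and every later innovation is a block by itself.\<close>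

lemma indep_inputs_from: "indep_vars (\<lambda>_. borel) (inputs_from h) UNIV"
proof -
  define K where "K n = (if n = 0 then {..h} else {n + h})" for n
  define g where "g n w = (if n = 0 then max_path c w h else w (n + h))" for n and w :: "nat \<Rightarrow> real^'d"
  have g: "g n \<in> borel_measurable (Pi\<^sub>M (K n) (\<lambda>_. borel))" for n
    by (cases "n = 0")
       (auto simp: g_def[abs_def] K_def intro: measurable_max_path measurable_component_singleton)
  have "disjoint_family_on K UNIV"
    by (auto simp: disjoint_family_on_def K_def)
  then have "indep_vars (\<lambda>n. Pi\<^sub>M (K n) (\<lambda>_. borel))
      (\<lambda>n \<omega>. restrict (\<lambda>i. inputs_from 0 i \<omega>) (K n)) UNIV"
    by (intro indep_vars_restrict[OF indep_inputs_0]) auto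
  from indep_vars_compose2[OF this, of g, OF g]
  have *: "indep_vars (\<lambda>_. borel) (\<lambda>n \<omega>. g n (restrict (\<lambda>i. inputs_from 0 i \<omega>) (K n))) UNIV" .
  \<comment> \<open>The recursion holds on the sample space only, so the two families agree there but need not
      be equal as functions.\<close>
  have eq: "g n (restrict (\<lambda>i. inputs_from 0 i \<omega>) (K n)) = inputs_from h n \<omega>" if "\<omega> \<in> space M" for n \<omega>
  proof (cases "n = 0")
    case True
    have "max_path c (restrict (\<lambda>i. inputs_from 0 i \<omega>) {..h}) h = max_path c (\<lambda>i. inputs_from 0 i \<omega>) h"
      by (rule max_path_cong) auto
    also have "\<dots> = X h \<omega>" using X_eq_max_path[OF that, of h 0] by simp
    finally show ?thesis using True by (simp add: g_def K_def inputs_from_def)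
  qed (simp add: g_def K_def inputs_from_def)
  have rv: "inputs_from h n \<in> borel_measurable M" for n
    by (simp add: inputs_from_def measurable_Y)
  have pre: "(\<lambda>\<omega>. g n (restrict (\<lambda>i. inputs_from 0 i \<omega>) (K n))) -` A \<inter> space M
      = inputs_from h n -` A \<inter> space M" for n A
    using eq by auto
  show ?thesis
    using * rv unfolding indep_vars_def2 pre by simp
qed

lemma indep_X_Y: "indep_var borel (X n) borel (Y (Suc n))"
proof -
  have "indep_var borel ((\<lambda>w. w 0) \<circ> (\<lambda>\<omega>. restrict (\<lambda>i. inputs_from n i \<omega>) {0}))
     borel ((\<lambda>w. w 1) \<circ> (\<lambda>\<omega>. restrict (\<lambda>i. inputs_from n i \<omega>) {1}))"
    by (rule indep_var_compose[OF indep_var_restrict[OF indep_inputs_from]])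
       (auto intro: measurable_component_singleton)
  then show ?thesis by (simp add: comp_def inputs_from_def)
qed

lemma df_X_Suc:
  assumes "\<And>j. 0 < c $ j"
  shows "joint_cdf (distr M borel (X (Suc n))) x
    = joint_cdf (distr M borel (X n)) (scaled c 1 x) * G x"
proof -
  have [measurable]: "Y (Suc n) \<in> borel_measurable M" by (rule measurable_Y) simp
  have "joint_cdf (distr M borel (X (Suc n))) x = prob (X (Suc n) -` {..x} \<inter> space M)"
    by (simp add: joint_cdf_def measure_distr)
  also have "X (Suc n) -` {..x} \<inter> space M
      = (\<lambda>\<omega>. (X n \<omega>, Y (Suc n) \<omega>)) -` ({..scaled c 1 x} \<times> {..x}) \<inter> space M"
    by (auto simp: X_Suc max_step_le_iff[OF assms])
  also have "prob \<dots> = prob (X n -` {..scaled c 1 x} \<inter> space M) * prob (Y (Suc n) -` {..x} \<inter> space M)"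
    by (rule indep_varD[OF indep_X_Y]) auto
  also have "prob (X n -` {..scaled c 1 x} \<inter> space M) = joint_cdf (distr M borel (X n)) (scaled c 1 x)"
    by (simp add: joint_cdf_def measure_distr)
  also have "prob (Y (Suc n) -` {..x} \<inter> space M) = joint_cdf (distr M borel (Y (Suc n))) x"
    by (simp add: joint_cdf_def measure_distr)
  also have "\<dots> = G x"
    using innovations[of "Suc n"] by (simp add: has_df_def)
  finally show ?thesis .
qed

lemma distr_X_Suc:
  "distr M borel (X (Suc n)) =
     distr (distr M borel (X n) \<Otimes>\<^sub>M distr M borel (Y (Suc n))) borel (\<lambda>(z, y). max_step c z y)"
proof -
  have [measurable]: "Y (Suc n) \<in> borel_measurable M" by (rule measurable_Y) simp
  have "distr M borel (X (Suc n)) = distr M borel (\<lambda>\<omega>. max_step c (X n \<omega>) (Y (Suc n) \<omega>))"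
    by (intro distr_cong) (simp_all add: X_Suc)
  also have "\<dots> = distr (distr M (borel \<Otimes>\<^sub>M borel) (\<lambda>\<omega>. (X n \<omega>, Y (Suc n) \<omega>)))
      borel (\<lambda>(z, y). max_step c z y)"
    by (subst distr_distr) (simp_all add: comp_def)
  also have "distr M (borel \<Otimes>\<^sub>M borel) (\<lambda>\<omega>. (X n \<omega>, Y (Suc n) \<omega>))
      = distr M borel (X n) \<Otimes>\<^sub>M distr M borel (Y (Suc n))"
    using indep_X_Y[of n] by (simp add: indep_var_distribution_eq)
  finally show ?thesis .
qed

text \<open>Invariance of the initial law under one step suffices for strict stationarity. By induction
  every \<open>X h\<close> then has the initial law, so by independence the inputs restarted at time \<open>h\<close> have
  the same product law for all \<open>h\<close>, and the path from time \<open>h\<close> on is the same function of them.\<close>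

lemma stationary_if_distr_X_1_eq_X_0:
  assumes X: "distr M borel (X 1) = distr M borel (X 0)"
    and Y: "\<And>n. n \<ge> 1 \<Longrightarrow> distr M borel (Y n) = \<mu>"
  shows "distr M borel (X n) = distr M borel (X 0)"
    and "stationary M (\<lambda>n. X (Suc n))"
proof -
  have X0: "distr M borel (X n) = distr M borel (X 0)" for n
  proof (induction n)
    case (Suc n)
    have "distr M borel (X (Suc n)) = distr M borel (X (Suc 0))"
      using distr_X_Suc[of n] distr_X_Suc[of 0] Suc Y by simp
    then show ?case using X by simp
  qed simp
  then show "distr M borel (X n) = distr M borel (X 0)" .
  have rv [measurable]: "inputs_from h n \<in> borel_measurable M" for h n
    by (simp add: inputs_from_def measurable_Y)
  have inputs: "distr M (Pi\<^sub>M UNIV (\<lambda>_. borel)) (\<lambda>\<omega> i. inputs_from h i \<omega>)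
      = Pi\<^sub>M UNIV (\<lambda>i. if i = 0 then distr M borel (X 0) else \<mu>)" for h
  proof -
    have "distr M (Pi\<^sub>M UNIV (\<lambda>_. borel)) (\<lambda>\<omega>. \<lambda>i\<in>UNIV. inputs_from h i \<omega>)
        = Pi\<^sub>M UNIV (\<lambda>i. distr M borel (inputs_from h i))"
      using indep_inputs_from[of h] by (subst (asm) indep_vars_iff_distr_eq_PiM) simp_all
    moreover have "distr M borel (inputs_from h i) = (if i = 0 then distr M borel (X 0) else \<mu>)" for i
      using X0[of h] by (simp add: inputs_from_def Y)
    ultimately show ?thesis by (simp add: restrict_UNIV)
  qed
  have path: "distr M (Pi\<^sub>M I (\<lambda>_. borel)) (\<lambda>\<omega>. \<lambda>i\<in>I. X (Suc i + h) \<omega>)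
      = distr (Pi\<^sub>M UNIV (\<lambda>i. if i = 0 then distr M borel (X 0) else \<mu>)) (Pi\<^sub>M I (\<lambda>_. borel))
          (\<lambda>w. \<lambda>i\<in>I. max_path c w (Suc i))" for I h
  proof -
    have paths: "(\<lambda>w. \<lambda>i\<in>I. max_path c w (Suc i))
        \<in> measurable (Pi\<^sub>M UNIV (\<lambda>_. borel)) (Pi\<^sub>M I (\<lambda>_. borel))"
      by (intro measurable_restrict measurable_max_path) simp
    have inp: "(\<lambda>\<omega> i. inputs_from h i \<omega>) \<in> measurable M (Pi\<^sub>M UNIV (\<lambda>_. borel))"
      by (intro measurable_PiM_single') (simp_all add: rv)
    have "distr M (Pi\<^sub>M I (\<lambda>_. borel)) (\<lambda>\<omega>. \<lambda>i\<in>I. X (Suc i + h) \<omega>)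
        = distr M (Pi\<^sub>M I (\<lambda>_. borel)) (\<lambda>\<omega>. \<lambda>i\<in>I. max_path c (\<lambda>i. inputs_from h i \<omega>) (Suc i))"
      by (intro distr_cong) (simp_all add: X_eq_max_path del: max_path.simps add_Suc)
    then show ?thesis
      unfolding inputs[of h, symmetric] distr_distr[OF paths inp] comp_def .
  qed
  show "stationary M (\<lambda>n. X (Suc n))"
    unfolding stationary_def using path[of _ 0] path by simp
qed

end

section \<open>The negative logarithm\<close>

lemma neg_log_mult:
  assumes "0 \<le> a" "a \<le> 1" "0 \<le> b" "b \<le> 1"
  shows "neg_log (a * b) = neg_log a + neg_log b"
proof (cases "a = 0 \<or> b = 0")
  case False
  with assms show ?thesis
    by (simp add: neg_log_def ln_mult add.commute flip: ennreal_plus)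
qed (auto simp: neg_log_def)

lemma neg_log_pos_finite_iff:
  assumes "0 \<le> p" "p \<le> 1"
  shows "0 < neg_log p \<and> neg_log p < \<infinity> \<longleftrightarrow> 0 < p \<and> p < 1"
  using assms by (auto simp: neg_log_def less_le)

text \<open>This turns the summability condition into the hypothesis of the Borel--Cantelli lemma.\<close>

lemma one_minus_le_neg_log:
  assumes "0 \<le> p" "p \<le> 1"
  shows "ennreal (1 - p) \<le> neg_log p"
  using assms ln_le_minus_one[of p] by (auto simp: neg_log_def intro!: ennreal_leI)

lemma tendsto_neg_log_0:
  assumes "(f \<longlongrightarrow> 1) F"
  shows "((\<lambda>n. neg_log (f n)) \<longlongrightarrow> 0) F"
proof -
  have "((\<lambda>n. ennreal (- ln (f n))) \<longlongrightarrow> ennreal (- ln 1)) F"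
    by (intro tendsto_intros assms) auto
  moreover have "eventually (\<lambda>n. 0 < f n) F"
    using order_tendstoD(1)[OF assms, of 0] by simp
  then have "eventually (\<lambda>n. ennreal (- ln (f n)) = neg_log (f n)) F"
    by eventually_elim (simp add: neg_log_def)
  ultimately show ?thesis
    by (simp add: tendsto_cong)
qed

section \<open>Distribution functions along scaled points\<close>

lemma distribution_function_bounds:
  assumes "distribution_function F"
  shows "0 \<le> F x" "F x \<le> 1"
proof -
  obtain \<mu> where \<mu>: "prob_space \<mu>" "F = joint_cdf \<mu>"
    using assms by (auto simp: distribution_function_def)
  then interpret prob_space \<mu> by simp
  show "0 \<le> F x" "F x \<le> 1" by (simp_all add: \<mu> joint_cdf_def)
qed

lemma distribution_function_mono:
  assumes "distribution_function F" "x \<le> y"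
  shows "F x \<le> F y"
proof -
  obtain \<mu> where \<mu>: "prob_space \<mu>" "sets \<mu> = sets borel" "F = joint_cdf \<mu>"
    using assms by (auto simp: distribution_function_def)
  then interpret prob_space \<mu> by simp
  show ?thesis using assms(2)
    by (auto simp: \<mu> joint_cdf_def intro!: finite_measure_mono)
qed

lemma has_df_imp_distribution_function:
  assumes "prob_space M" "has_df M X F"
  shows "distribution_function F"
  using assms prob_space.prob_space_distr[of M X borel]
  by (auto simp: has_df_def distribution_function_def intro!: exI[of _ "distr M borel X"])

lemma filterlim_scaled_nth:
  fixes c x :: "real^'d"
  assumes "0 < c $ j" "c $ j < 1" "0 < x $ j"
  shows "filterlim (\<lambda>n. scaled c n x $ j) at_top sequentially"
  using assms unfolding scaled_nth by real_asymp

lemma eventually_le_scaled: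
  fixes c x y :: "real^'d"
  assumes "\<And>j. 0 < c $ j \<and> c $ j < 1" "\<And>j. 0 < x $ j"
  shows "eventually (\<lambda>n. y \<le> scaled c n x) sequentially"
proof -
  have "eventually (\<lambda>n. y $ j \<le> scaled c n x $ j) sequentially" for j
    using filterlim_scaled_nth[of c j x] assms by (simp add: filterlim_at_top)
  then show ?thesis
    unfolding less_eq_vec_def by (rule eventually_all_finite)
qed

lemma distribution_function_scaled_tendsto_1:
  fixes c x :: "real^'d"
  assumes F: "distribution_function F"
    and c: "\<And>j. 0 < c $ j \<and> c $ j < 1" and x: "\<And>j. 0 < x $ j"
  shows "(\<lambda>n. F (scaled c n x)) \<longlonglongrightarrow> 1"
proof -
  obtain \<mu> where \<mu>: "prob_space \<mu>" "sets \<mu> = sets borel" "F = joint_cdf \<mu>"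
    using F by (auto simp: distribution_function_def)
  then interpret prob_space \<mu> by simp
  have "incseq (\<lambda>n. {..scaled c n x})"
  proof (rule incseq_SucI, simp add: less_eq_vec_def, intro allI)
    fix n j
    show "x $ j / c $ j ^ n \<le> x $ j / (c $ j * c $ j ^ n)"
      using c[of j] x[of j] by (intro divide_left_mono) (auto simp: mult_le_cancel_right1 mult_pos_pos)
  qed
  then have "(\<lambda>n. prob {..scaled c n x}) \<longlonglongrightarrow> prob (\<Union>n. {..scaled c n x})"
    by (intro finite_Lim_measure_incseq) (auto simp: \<mu>)
  also have "(\<Union>n. {..scaled c n x}) = space \<mu>"
  proof -
    have "\<exists>n. y \<le> scaled c n x" for y
      using eventually_happens[OF eventually_le_scaled[OF c x]] by auto
    then show ?thesis using sets_eq_imp_space_eq[OF \<mu>(2)] by auto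
  qed
  finally show ?thesis by (simp add: \<mu> joint_cdf_def prob_space)
qed

text \<open>A single negative coordinate is enough: dividing it by \<open>c $ j ^ n\<close> drives it to \<open>-\<infinity>\<close>,
  whatever the other coordinates do.\<close>

lemma distribution_function_scaled_tendsto_0:
  fixes c x :: "real^'d"
  assumes F: "distribution_function F"
    and c: "\<And>j. 0 < c $ j \<and> c $ j < 1" and x: "x $ j < 0"
  shows "(\<lambda>n. F (scaled c n x)) \<longlonglongrightarrow> 0"
proof -
  obtain \<mu> where \<mu>: "prob_space \<mu>" "sets \<mu> = sets borel" "F = joint_cdf \<mu>"
    using F by (auto simp: distribution_function_def)
  then interpret prob_space \<mu> by simp
  have lim: "filterlim (\<lambda>n. x $ j / c $ j ^ n) at_bot sequentially"
    using filterlim_scaled_nth[of c j "- x"] c[of j] x by (simp add: filterlim_uminus_at_bot)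
  \<comment> \<open>The orthants themselves need not decrease when the coordinates of \<open>x\<close> have mixed signs;
      the half-spaces that contain them do.\<close>
  define A where "A n = {y. y $ j \<le> x $ j / c $ j ^ n}" for n
  have A: "A n \<in> sets \<mu>" for n
    unfolding A_def \<mu>(2) by measurable
  have "decseq A"
  proof (rule decseq_SucI)
    fix n
    have "x $ j / (c $ j * c $ j ^ n) \<le> x $ j / c $ j ^ n"
      using c[of j] x by (intro divide_left_mono_neg) (auto simp: mult_le_cancel_right1 mult_pos_pos)
    then show "A (Suc n) \<subseteq> A n" by (auto simp: A_def)
  qed
  then have "(\<lambda>n. prob (A n)) \<longlonglongrightarrow> prob (\<Inter>n. A n)"
    using A by (intro finite_Lim_measure_decseq) auto
  also have "(\<Inter>n. A n) = {}"
  proof -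
    have "\<exists>n. y \<notin> A n" for y
    proof -
      have "eventually (\<lambda>n. x $ j / c $ j ^ n < y $ j) sequentially"
        using lim by (simp add: filterlim_at_bot_dense)
      from eventually_happens[OF this] show ?thesis by (auto simp: A_def not_le)
    qed
    then show ?thesis by auto
  qed
  finally have "(\<lambda>n. prob (A n)) \<longlonglongrightarrow> 0" by simp
  then show ?thesis
    by (rule tendsto_sandwich[OF _ _ tendsto_const, rotated 2])
       (auto simp: \<mu> joint_cdf_def A_def less_eq_vec_def
             intro!: always_eventually finite_measure_mono A[unfolded A_def \<mu>(2)])
qed

lemma distribution_function_right_continuous:
  fixes x :: "real^'d"
  assumes F: "distribution_function F"
  shows "(\<lambda>n. F (\<chi> j. x $ j + inverse (Suc n))) \<longlonglongrightarrow> F x"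
proof -
  obtain \<mu> where \<mu>: "prob_space \<mu>" "sets \<mu> = sets borel" "F = joint_cdf \<mu>"
    using F by (auto simp: distribution_function_def)
  then interpret prob_space \<mu> by simp
  have "decseq (\<lambda>n. {..\<chi> j. x $ j + inverse (real (Suc n))})"
    by (intro decseq_SucI) (auto simp: less_eq_vec_def field_simps intro: order_trans)
  then have "(\<lambda>n. prob {..\<chi> j. x $ j + inverse (Suc n)}) \<longlonglongrightarrow> prob (\<Inter>n. {..\<chi> j. x $ j + inverse (Suc n)})"
    by (intro finite_Lim_measure_decseq) (auto simp: \<mu>)
  also have "(\<Inter>n. {..\<chi> j. x $ j + inverse (Suc n)}) = {..x}"
  proof -
    have "y $ j \<le> x $ j" if "\<And>n. y $ j \<le> x $ j + inverse (Suc n)" for y :: "real^'d" and j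
    proof (rule LIMSEQ_le_const)
      show "(\<lambda>n. x $ j + inverse (Suc n)) \<longlonglongrightarrow> x $ j" by (rule LIMSEQ_inverse_real_of_nat_add)
    qed (use that in auto)
    then show ?thesis
      by (fastforce simp: less_eq_vec_def intro: order_trans add_increasing2)
  qed
  finally show ?thesis by (simp add: \<mu> joint_cdf_def)
qed

section \<open>The functional equation and the series\<close>

text \<open>Iterating the functional equation \<open>n\<close> times peels off \<open>n\<close> factors of \<open>G\<close> and leaves the
  remainder \<open>F (scaled c (Suc n) x)\<close>, which tends to 1 when \<open>x\<close> is positive. So \<open>F\<close>
  is an infinite product of values of \<open>G\<close> at positive points, and the series, which starts at index
  1, is its negative logarithm one scaling step away from \<open>x\<close>.\<close>

lemma suminf_neg_log_df:
  fixes c x :: "real^'d"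
  assumes F: "distribution_function F" and G: "distribution_function G"
    and c: "\<And>j. 0 < c $ j \<and> c $ j < 1" and x: "\<And>j. 0 < x $ j"
    and eq: "\<And>x. F x = F (scaled c 1 x) * G x"
  shows "(\<Sum>i. neg_log (G (scaled c (Suc i) x))) = neg_log (F (scaled c 1 x))"
proof -
  have step: "neg_log (F (scaled c i x)) = neg_log (F (scaled c (Suc i) x)) + neg_log (G (scaled c i x))" for i
    using eq[of "scaled c i x"] distribution_function_bounds[OF F] distribution_function_bounds[OF G]
    by (simp add: scaled_scaled neg_log_mult)
  have *: "(\<Sum>i<n. neg_log (G (scaled c (Suc i) x))) + neg_log (F (scaled c (Suc n) x))
      = neg_log (F (scaled c 1 x))" for n
  proof (induction n)
    case (Suc n)
    then show ?case
      unfolding step[of "Suc n"] by (simp add: ac_simps)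
  qed simp
  have "(\<lambda>n. neg_log (F (scaled c (Suc n) x))) \<longlonglongrightarrow> 0"
    by (intro tendsto_neg_log_0 LIMSEQ_Suc distribution_function_scaled_tendsto_1 F c x)
  then have "(\<lambda>n. (\<Sum>i<n. neg_log (G (scaled c (Suc i) x))) + neg_log (F (scaled c (Suc n) x)))
      \<longlonglongrightarrow> (\<Sum>i. neg_log (G (scaled c (Suc i) x))) + 0"
    by (intro tendsto_add summable_LIMSEQ) auto
  then show ?thesis
    unfolding * by (simp add: LIMSEQ_const_iff)
qed

text \<open>Non-degeneracy may be witnessed at any point of the space, the summability condition only at
  positive ones. The functional equation bounds \<open>F x\<close> by \<open>F (scaled c n x)\<close>, which tends to 0 if
  \<open>x\<close> has a negative coordinate; so a witness is nonnegative, and right continuity moves it into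
  the open positive orthant.\<close>

lemma nondegenerate_pos:
  fixes c :: "real^'d"
  assumes F: "distribution_function F" and G: "distribution_function G"
    and c: "\<And>j. 0 < c $ j \<and> c $ j < 1"
    and eq: "\<And>x. F x = F (scaled c 1 x) * G x"
    and "nondegenerate F"
  obtains y where "\<And>j. 0 < y $ j" "0 < F y" "F y < 1"
proof -
  obtain x where x: "0 < F x" "F x < 1"
    using \<open>nondegenerate F\<close> by (auto simp: nondegenerate_def)
  have le: "F x \<le> F (scaled c n x)" for n
  proof (induction n)
    case (Suc n)
    have "F (scaled c n x) \<le> F (scaled c (Suc n) x)"
      using eq[of "scaled c n x"] distribution_function_bounds[OF F] distribution_function_bounds[OF G]
      by (simp add: scaled_scaled mult_left_le)
    with Suc show ?case by linarith
  qed simp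
  have nonneg: "0 \<le> x $ j" for j
  proof (rule ccontr)
    assume "\<not> 0 \<le> x $ j"
    then have "F x \<le> 0"
      using distribution_function_scaled_tendsto_0[OF F c, of x j] le by (intro LIMSEQ_le_const) auto
    with x show False by simp
  qed
  have "eventually (\<lambda>n. F (\<chi> j. x $ j + inverse (Suc n)) < 1) sequentially"
    using order_tendstoD(2)[OF distribution_function_right_continuous[OF F] x(2)] .
  from eventually_happens[OF this] obtain n where n: "F (\<chi> j. x $ j + inverse (Suc n)) < 1"
    by auto
  show ?thesis
  proof
    show "0 < (\<chi> j. x $ j + inverse (Suc n)) $ j" for j
      using nonneg[of j] by (simp add: add_nonneg_pos)
    have "F x \<le> F (\<chi> j. x $ j + inverse (Suc n))"
      by (intro distribution_function_mono[OF F]) (simp add: less_eq_vec_def)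
    with x show "0 < F (\<chi> j. x $ j + inverse (Suc n))" by linarith
  qed (fact n)
qed

lemma summability_condition_iff_nondegenerate:
  fixes c :: "real^'d"
  assumes F: "distribution_function F" and G: "distribution_function G"
    and c: "\<And>j. 0 < c $ j \<and> c $ j < 1"
    and eq: "\<And>x. F x = F (scaled c 1 x) * G x"
  shows "summability_condition c G \<longleftrightarrow> nondegenerate F"
proof -
  have "summability_condition c G \<longleftrightarrow>
      (\<exists>x. (\<forall>j. 0 < x $ j) \<and> 0 < F (scaled c 1 x) \<and> F (scaled c 1 x) < 1)"
    unfolding summability_condition_def
    using suminf_neg_log_df[OF F G c _ eq] neg_log_pos_finite_iff distribution_function_bounds[OF F]
    by (smt (verit, best))
  also have "\<dots> \<longleftrightarrow> nondegenerate F"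
  proof
    assume "nondegenerate F"
    then obtain y where y: "\<And>j. 0 < y $ j" "0 < F y" "F y < 1"
      using nondegenerate_pos[OF F G c eq] by blast
    \<comment> \<open>The series starts at index 1, hence it is evaluated one scaling step before \<open>y\<close>.\<close>
    have "scaled c 1 (\<chi> j. c $ j * y $ j) = y"
      using c by (simp add: vec_eq_iff less_imp_neq[THEN not_sym])
    with y c show "\<exists>x. (\<forall>j. 0 < x $ j) \<and> 0 < F (scaled c 1 x) \<and> F (scaled c 1 x) < 1"
      by (intro exI[of _ "\<chi> j. c $ j * y $ j"]) simp
  qed (auto simp: nondegenerate_def)
  finally show ?thesis .
qed

section \<open>The supremum over an infinite past\<close>

text \<open>The vector \<open>sup\<^sub>i c\<^sup>i z\<^sub>i\<close>, computed coordinatewise. When \<open>z\<^sub>i\<close> is the innovation that arrived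
  \<open>i\<close> steps ago, it is the state of a process that has run forever. The supremum is taken in the
  extended reals, where measurability does not depend on boundedness.\<close>

definition discounted_sup :: "real^'d \<Rightarrow> (nat \<Rightarrow> real^'d) \<Rightarrow> real^'d" where
  "discounted_sup c z = (\<chi> j. real_of_ereal (SUP i. ereal (c $ j ^ i * z i $ j)))"

definition discounted_bdd :: "real^'d \<Rightarrow> (nat \<Rightarrow> real^'d) \<Rightarrow> bool" where
  "discounted_bdd c z \<longleftrightarrow> (\<exists>x. \<forall>i. z i \<le> scaled c i x)"

lemma measurable_discounted_sup [measurable]:
  "discounted_sup c \<in> borel_measurable (Pi\<^sub>M UNIV (\<lambda>_. borel))"
  unfolding discounted_sup_def[abs_def]
  by (intro borel_measurable_vec_lambda) measurable

text \<open>Orthants determine a vector, so this lemma gives all that is needed about the supremum. The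
  term at index 0 keeps the extended supremum away from \<open>-\<infinity>\<close>, and boundedness keeps it
  away from \<open>\<infinity>\<close>, so that the conversion to a real is faithful.\<close>

lemma discounted_sup_le_iff:
  fixes c :: "real^'d"
  assumes c: "\<And>j. 0 < c $ j" and "discounted_bdd c z"
  shows "discounted_sup c z \<le> x \<longleftrightarrow> (\<forall>i. z i \<le> scaled c i x)"
proof -
  obtain b where b: "\<And>i. z i \<le> scaled c i b"
    using assms(2) by (auto simp: discounted_bdd_def)
  have le: "ereal (c $ j ^ i * z i $ j) \<le> ereal t \<longleftrightarrow> z i $ j \<le> t / c $ j ^ i" for i j t
    using c[of j] by (simp add: pos_le_divide_eq mult.commute)
  have "discounted_sup c z $ j \<le> x $ j \<longleftrightarrow> (\<forall>i. z i $ j \<le> x $ j / c $ j ^ i)" for j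
  proof -
    define s where "s = (SUP i. ereal (c $ j ^ i * z i $ j))"
    have "s \<le> ereal (b $ j)"
      unfolding s_def SUP_le_iff le using b by (simp add: less_eq_vec_def)
    moreover have "ereal (z 0 $ j) \<le> s"
      unfolding s_def by (rule SUP_upper2[of 0]) auto
    ultimately have "real_of_ereal s \<le> x $ j \<longleftrightarrow> s \<le> ereal (x $ j)"
      by (cases s) auto
    also have "\<dots> \<longleftrightarrow> (\<forall>i. z i $ j \<le> x $ j / c $ j ^ i)"
      unfolding s_def SUP_le_iff le by simp
    finally show ?thesis by (simp add: discounted_sup_def s_def)
  qed
  then show ?thesis by (auto simp: less_eq_vec_def)
qed

text \<open>The supremum over an infinite past satisfies the recursion: a new innovation shifts all the
  older ones by one index, which multiplies them by \<open>c\<close>. Both sides lie below the same vectors.\<close>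

lemma discounted_sup_case_nat:
  fixes c :: "real^'d"
  assumes c: "\<And>j. 0 < c $ j" and "discounted_bdd c (case_nat y z)"
  shows "discounted_sup c (case_nat y z) = max_step c (discounted_sup c z) y"
proof -
  have all: "(\<forall>i. case_nat y z i \<le> scaled c i x) \<longleftrightarrow> y \<le> x \<and> (\<forall>i. z i \<le> scaled c i (scaled c 1 x))" for x
    by (auto simp: scaled_scaled split: nat.split)
  have "discounted_bdd c z"
    using assms(2) unfolding discounted_bdd_def all by blast
  then have "discounted_sup c (case_nat y z) \<le> x \<longleftrightarrow> max_step c (discounted_sup c z) y \<le> x" for x
    using discounted_sup_le_iff[OF c assms(2)] discounted_sup_le_iff[OF c]
    unfolding max_step_le_iff[OF c] all by blast
  then show ?thesis by (metis order.antisym order.refl)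
qed

lemma discounted_bdd_eventually:
  fixes c :: "real^'d"
  assumes c: "\<And>j. 0 < c $ j" and x: "\<And>j. 0 < x $ j"
    and ev: "eventually (\<lambda>i. z i \<le> scaled c i x) sequentially"
  shows "discounted_bdd c z"
proof -
  obtain n where n: "\<And>i. n \<le> i \<Longrightarrow> z i \<le> scaled c i x"
    using ev by (auto simp: eventually_sequentially)
  \<comment> \<open>The finitely many exceptional terms are absorbed by adding their absolute values to the
      eventual bound.\<close>
  define b :: "real^'d" where "b = (\<chi> j. x $ j + (\<Sum>i<n. \<bar>c $ j ^ i * z i $ j\<bar>))"
  have "c $ j ^ i * z i $ j \<le> b $ j" for i j
  proof (cases "i < n")
    case True
    have "c $ j ^ i * z i $ j \<le> \<bar>c $ j ^ i * z i $ j\<bar>" by simp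
    also have "\<dots> \<le> (\<Sum>i<n. \<bar>c $ j ^ i * z i $ j\<bar>)"
      using True by (intro member_le_sum) auto
    finally show ?thesis using x[of j] by (simp add: b_def)
  next
    case False
    then have "z i $ j \<le> x $ j / c $ j ^ i"
      using n[of i] by (simp add: less_eq_vec_def)
    then have "c $ j ^ i * z i $ j \<le> x $ j"
      using c[of j] by (simp add: pos_le_divide_eq mult.commute)
    then show ?thesis by (simp add: b_def add_increasing2 sum_nonneg)
  qed
  then have "z i \<le> scaled c i b" for i
    using c by (simp add: less_eq_vec_def pos_le_divide_eq mult.commute)
  then show ?thesis by (auto simp: discounted_bdd_def)
qed

text \<open>Borel--Cantelli: innovation \<open>i\<close> fails to lie below \<open>scaled c i x\<close> with a probability of
  \<open>1 - joint_cdf \<mu> (scaled c i x)\<close>, which is at most the corresponding term of the convergent series. So almost surely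
  only finitely many discounted innovations leave the orthant below \<open>x\<close>.\<close>

lemma AE_discounted_bdd:
  fixes c :: "real^'d"
  assumes \<mu>: "prob_space \<mu>" "sets \<mu> = sets borel"
    and c: "\<And>j. 0 < c $ j" and x: "\<And>j. 0 < x $ j"
    and sum: "(\<Sum>i. neg_log (joint_cdf \<mu> (scaled c (Suc i) x))) < \<infinity>"
  shows "AE z in Pi\<^sub>M UNIV (\<lambda>_::nat. \<mu>). discounted_bdd c z"
proof -
  interpret \<mu>: prob_space \<mu> by fact
  let ?P = "Pi\<^sub>M UNIV (\<lambda>_::nat. \<mu>)"
  interpret P: prob_space ?P by (rule prob_space_PiM) (rule \<mu>(1))
  note [measurable_cong] = \<mu>(2)
  define A where "A i = {z \<in> space ?P. \<not> z (Suc i) \<le> scaled c (Suc i) x}" for i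
  have space: "space \<mu> = UNIV" using sets_eq_imp_space_eq[OF \<mu>(2)] by simp
  have A: "A i \<in> sets ?P"
      and P_A: "P.prob (A i) = 1 - joint_cdf \<mu> (scaled c (Suc i) x)" for i
  proof -
    have m: "(\<lambda>z. z (Suc i)) \<in> measurable ?P \<mu>" by (rule measurable_component_singleton) simp
    have s: "space \<mu> - {..scaled c (Suc i) x} \<in> sets \<mu>" by (auto simp: \<mu>(2) space)
    have eq: "A i = (\<lambda>z. z (Suc i)) -` (space \<mu> - {..scaled c (Suc i) x}) \<inter> space ?P"
      by (auto simp: A_def space)
    show "A i \<in> sets ?P" unfolding eq by (rule measurable_sets[OF m s])
    have "P.prob (A i) = measure (distr ?P \<mu> (\<lambda>z. z (Suc i))) (space \<mu> - {..scaled c (Suc i) x})"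
      unfolding eq by (rule measure_distr[OF m s, symmetric])
    also have "distr ?P \<mu> (\<lambda>z. z (Suc i)) = \<mu>"
      by (rule distr_PiM_component) (auto intro: \<mu>)
    also have "\<mu>.prob (space \<mu> - {..scaled c (Suc i) x}) = 1 - joint_cdf \<mu> (scaled c (Suc i) x)"
      unfolding joint_cdf_def by (rule \<mu>.prob_compl) (simp add: \<mu>(2))
    finally show "P.prob (A i) = 1 - joint_cdf \<mu> (scaled c (Suc i) x)" .
  qed
  have F: "distribution_function (joint_cdf \<mu>)"
    using \<mu> by (auto simp: distribution_function_def)
  have "(\<Sum>i. ennreal (P.prob (A i))) \<le> (\<Sum>i. neg_log (joint_cdf \<mu> (scaled c (Suc i) x)))"
    unfolding P_A by (intro suminf_le one_minus_le_neg_log distribution_function_bounds[OF F]) auto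
  with sum have "(\<Sum>i. ennreal (P.prob (A i))) < \<infinity>" by (rule order.strict_trans1[rotated])
  then have "summable (\<lambda>i. P.prob (A i))"
    by (intro summable_suminf_not_top) auto
  then have "AE z in ?P. eventually (\<lambda>i. z \<in> space ?P - A i) sequentially"
    by (intro borel_cantelli_AE1 A) (auto simp: P.emeasure_eq_measure)
  then show ?thesis
  proof eventually_elim
    case (elim z)
    then have "eventually (\<lambda>i. z (Suc i) \<le> scaled c (Suc i) x) sequentially"
      by eventually_elim (auto simp: A_def)
    then have "eventually (\<lambda>i. z i \<le> scaled c i x) sequentially"
      by (rule eventually_sequentially_Suc[THEN iffD1])
    then show ?case by (rule discounted_bdd_eventually[OF c x])
  qed
qed

text \<open>The law of the supremum is invariant under one step: putting an independent innovation in
  front of an i.i.d. sequence gives an i.i.d. sequence with the same law, and by the recursion for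
  the supremum this is one step of the process.\<close>

lemma distr_discounted_sup:
  fixes c :: "real^'d"
  assumes \<mu>: "prob_space \<mu>" "sets \<mu> = sets borel" and c: "\<And>j. 0 < c $ j"
    and bdd: "AE z in Pi\<^sub>M UNIV (\<lambda>_::nat. \<mu>). discounted_bdd c z"
  defines "\<nu> \<equiv> distr (Pi\<^sub>M UNIV (\<lambda>_::nat. \<mu>)) borel (discounted_sup c)"
  shows "distr (\<nu> \<Otimes>\<^sub>M \<mu>) borel (\<lambda>(z, y). max_step c z y) = \<nu>"
proof -
  interpret \<mu>: prob_space \<mu> by fact
  interpret product_prob_space "\<lambda>_::nat. \<mu>" UNIV ..
  interpret sequence_space \<mu> ..
  note [measurable_cong] = \<mu>(2)
  have sets_S [measurable_cong]: "sets S = sets (Pi\<^sub>M UNIV (\<lambda>_. borel))"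
    by (intro sets_PiM_cong) (auto simp: \<mu>(2))
  have sup [measurable]: "discounted_sup c \<in> borel_measurable S" by measurable
  have sets_\<nu> [measurable_cong]: "sets \<nu> = sets borel" by (simp add: \<nu>_def)
  interpret \<nu>: prob_space \<nu> 
    unfolding \<nu>_def by (rule prob_space.prob_space_distr[OF prob_space_PiM]) (auto intro: \<mu>)
  interpret \<mu>\<nu>: pair_sigma_finite \<mu> \<nu> ..
  have cons [measurable]: "(\<lambda>(y, z). case_nat y z) \<in> measurable (\<mu> \<Otimes>\<^sub>M S) S"
    by measurable
  have "\<nu> = distr (distr (\<mu> \<Otimes>\<^sub>M S) S (\<lambda>(y, z). case_nat y z)) borel (discounted_sup c)"
    unfolding \<nu>_def PiM_iter ..
  also have "\<dots> = distr (\<mu> \<Otimes>\<^sub>M S) borel (\<lambda>(y, z). discounted_sup c (case_nat y z))"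
    by (subst distr_distr[OF sup cons]) (simp add: comp_def split_beta')
  also have "\<dots> = distr (\<mu> \<Otimes>\<^sub>M S) borel (\<lambda>(y, z). max_step c (discounted_sup c z) y)"
  proof (rule distr_cong_AE)
    have "AE z in distr (\<mu> \<Otimes>\<^sub>M S) S (\<lambda>(y, z). case_nat y z). discounted_bdd c z"
      unfolding PiM_iter by (rule bdd)
    from AE_distrD[OF cons this]
    show "AE p in \<mu> \<Otimes>\<^sub>M S. (case p of (y, z) \<Rightarrow> discounted_sup c (case_nat y z))
        = (case p of (y, z) \<Rightarrow> max_step c (discounted_sup c z) y)"
      by eventually_elim (auto simp: discounted_sup_case_nat[OF c])
  qed (auto simp: split_beta')
  also have "\<dots> = distr (distr (\<mu> \<Otimes>\<^sub>M S) (\<mu> \<Otimes>\<^sub>M borel) (\<lambda>(y, z). (y, discounted_sup c z)))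
      borel (\<lambda>(y, v). max_step c v y)"
    by (subst distr_distr) (auto simp: comp_def split_beta')
  also have "distr (\<mu> \<Otimes>\<^sub>M S) (\<mu> \<Otimes>\<^sub>M borel) (\<lambda>(y, z). (y, discounted_sup c z)) = \<mu> \<Otimes>\<^sub>M \<nu>"
    using pair_measure_distr[of "\<lambda>y. y" \<mu> \<mu> "discounted_sup c" S borel] \<nu>.sigma_finite_measure_axioms
    by (simp add: \<nu>_def distr_id2)
  also have "distr (\<mu> \<Otimes>\<^sub>M \<nu>) borel (\<lambda>(y, v). max_step c v y)
      = distr (distr (\<nu> \<Otimes>\<^sub>M \<mu>) (\<mu> \<Otimes>\<^sub>M \<nu>) (\<lambda>(v, y). (y, v))) borel (\<lambda>(y, v). max_step c v y)"
    by (subst \<mu>\<nu>.distr_pair_swap) simp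
  also have "\<dots> = distr (\<nu> \<Otimes>\<^sub>M \<mu>) borel (\<lambda>(z, y). max_step c z y)"
    by (subst distr_distr) (auto simp: comp_def split_beta')
  finally show ?thesis ..
qed

section \<open>Stationary processes\<close>

lemma stationary_max_ar_imp:
  fixes c :: "real^'d"
  assumes ar: "stationary_max_ar M c F0 G X Y F"
    and G: "distribution_function G" and c: "\<And>j. 0 < c $ j \<and> c $ j < 1"
  shows "summability_condition c G" and "F x = F (scaled c 1 x) * G x"
proof -
  interpret max_ar M c F0 G X Y using ar by (simp add: stationary_max_ar_def)
  have F: "has_df M (X n) F" if "n \<ge> 1" for n
    using ar that by (simp add: stationary_max_ar_def)
  have eq: "F x = F (scaled c 1 x) * G x" for x
    using df_X_Suc[of 1 x] F[of 1] F[of 2] c by (simp add: has_df_def numeral_2_eq_2)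
  then show "F x = F (scaled c 1 x) * G x" .
  have "distribution_function F"
    using F[of 1] prob_space_axioms by (auto intro: has_df_imp_distribution_function)
  then show "summability_condition c G"
    using summability_condition_iff_nondegenerate[OF _ G c eq] ar
    by (simp add: stationary_max_ar_def)
qed

text \<open>The canonical model: the coordinates of \<open>nat \<Rightarrow> real^'d\<close> are the inputs, independent under
  the product measure, and the process is the path that they generate.\<close>

lemma stationary_max_ar_if_invariant:
  fixes c :: "real^'d" and \<mu> \<nu> :: "(real^'d) measure"
  assumes \<mu>: "prob_space \<mu>" "sets \<mu> = sets borel"
    and \<nu>: "prob_space \<nu>" "sets \<nu> = sets borel"
    and inv: "distr (\<nu> \<Otimes>\<^sub>M \<mu>) borel (\<lambda>(z, y). max_step c z y) = \<nu>"
  defines "M \<equiv> Pi\<^sub>M UNIV (\<lambda>n::nat. if n = 0 then \<nu> else \<mu>)"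
    and "X \<equiv> \<lambda>n w. max_path c w n" and "Y \<equiv> \<lambda>n w. w n"
  shows "max_ar M c (joint_cdf \<nu>) (joint_cdf \<mu>) X Y"
    and "stationary M (\<lambda>n. X (Suc n))"
    and "has_df M (X n) (joint_cdf \<nu>)"
proof -
  define N where "N n = (if n = 0 then \<nu> else \<mu>)" for n :: nat
  have M: "M = Pi\<^sub>M UNIV N" by (simp add: M_def N_def[abs_def])
  have N: "prob_space (N n)" "sets (N n) = sets borel" for n by (auto simp: N_def \<mu> \<nu>)
  interpret prob_space M unfolding M by (rule prob_space_PiM) (rule N)
  have sets_M [measurable_cong]: "sets M = sets (Pi\<^sub>M UNIV (\<lambda>_. borel))"
    unfolding M by (intro sets_PiM_cong) (auto simp: N)
  have coord [measurable]: "(\<lambda>w. w n) \<in> borel_measurable M" for n by measurable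
  have distr_coord: "distr M borel (\<lambda>w. w n) = N n" for n
  proof -
    have "distr M borel (\<lambda>w. w n) = distr M (N n) (\<lambda>w. w n)"
      by (intro distr_cong) (auto simp: N)
    also have "\<dots> = N n" unfolding M by (rule distr_PiM_component) (auto intro: N)
    finally show ?thesis .
  qed
  have "indep_vars (\<lambda>_. borel) (\<lambda>n w. w n) UNIV"
  proof (subst indep_vars_iff_distr_eq_PiM)
    have "distr M (Pi\<^sub>M UNIV (\<lambda>_. borel)) (\<lambda>w. \<lambda>i\<in>UNIV. w i) = distr M M (\<lambda>w. w)"
      by (intro distr_cong) (auto simp: sets_M restrict_UNIV)
    also have "\<dots> = M" by simp
    also have "M = Pi\<^sub>M UNIV (\<lambda>i. distr M borel (\<lambda>w. w i))" unfolding distr_coord by (rule M)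
    finally show "distr M (Pi\<^sub>M UNIV (\<lambda>_. borel)) (\<lambda>w. \<lambda>i\<in>UNIV. w i)
        = Pi\<^sub>M UNIV (\<lambda>i. distr M borel (\<lambda>w. w i))" .
  qed auto
  moreover have "(\<lambda>n. if n = 0 then X 0 else Y n) = (\<lambda>n w. w n)"
    by (auto simp: X_def Y_def fun_eq_iff)
  moreover have "X (Suc n) w $ j = max (c $ j * X n w $ j) (Y (Suc n) w $ j)" for n w j
    by (simp add: X_def Y_def max_step_def)
  then have "X n w $ j = max (c $ j * X (n - 1) w $ j) (Y n w $ j)" if "n \<ge> 1" for n w j
    using that by (cases n) auto
  ultimately show ar: "max_ar M c (joint_cdf \<nu>) (joint_cdf \<mu>) X Y"
    by unfold_locales
       (use distr_coord in \<open>auto simp: has_df_def X_def Y_def N_def\<close>)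
  interpret ar: max_ar M c "joint_cdf \<nu>" "joint_cdf \<mu>" X Y by (fact ar)
  have XY: "distr M borel (Y n) = \<mu>" if "n \<ge> 1" for n
    using distr_coord[of n] that by (simp add: Y_def N_def)
  have X0: "distr M borel (X 0) = \<nu>"
    using distr_coord[of 0] by (simp add: X_def N_def)
  have "distr M borel (X 1) = distr (distr M borel (X 0) \<Otimes>\<^sub>M distr M borel (Y 1)) borel (\<lambda>(z, y). max_step c z y)"
    using ar.distr_X_Suc[of 0] by simp
  also have "\<dots> = distr M borel (X 0)"
    by (simp add: X0 XY inv)
  finally have X1: "distr M borel (X 1) = distr M borel (X 0)" .
  show "stationary M (\<lambda>n. X (Suc n))"
    by (rule ar.stationary_if_distr_X_1_eq_X_0[OF X1 XY])
  show "has_df M (X n) (joint_cdf \<nu>)"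
    using ar.stationary_if_distr_X_1_eq_X_0(1)[OF X1 XY] by (simp add: has_df_def X0)
qed

text \<open>The series enters twice: its finiteness makes the supremum, and with it the invariant law,
  exist; its positivity together with finiteness makes that law non-degenerate, through the
  functional equation that the constructed process satisfies.\<close>

lemma ex_stationary_max_ar:
  fixes c :: "real^'d"
  assumes G: "distribution_function G" and c: "\<And>j. 0 < c $ j \<and> c $ j < 1"
    and sum: "summability_condition c G"
  shows "\<exists>F0 F (M :: (nat \<Rightarrow> real^'d) measure) X Y. stationary_max_ar M c F0 G X Y F"
proof -
  obtain \<mu> where \<mu>: "prob_space \<mu>" "sets \<mu> = sets borel" and G_eq: "G = joint_cdf \<mu>"
    using G by (auto simp: distribution_function_def)
  obtain x where x: "\<And>j. 0 < x $ j" and "(\<Sum>i. neg_log (G (scaled c (Suc i) x))) < \<infinity>"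
    using sum by (auto simp: summability_condition_def)
  then have "AE z in Pi\<^sub>M UNIV (\<lambda>_::nat. \<mu>). discounted_bdd c z"
    using c by (intro AE_discounted_bdd[OF \<mu> _ x]) (simp_all add: G_eq)
  define P where "P = Pi\<^sub>M UNIV (\<lambda>_::nat. \<mu>)"
  define \<nu> where "\<nu> = distr P borel (discounted_sup c)"
  interpret P: prob_space P unfolding P_def by (rule prob_space_PiM) (rule \<mu>)
  have "sets P = sets (Pi\<^sub>M UNIV (\<lambda>_. borel))"
    unfolding P_def by (intro sets_PiM_cong) (auto simp: \<mu>)
  note [measurable_cong] = this
  have \<nu>: "prob_space \<nu>" "sets \<nu> = sets borel"
    unfolding \<nu>_def by (auto intro!: P.prob_space_distr)
  have inv: "distr (\<nu> \<Otimes>\<^sub>M \<mu>) borel (\<lambda>(z, y). max_step c z y) = \<nu>"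
    unfolding \<nu>_def P_def using c by (intro distr_discounted_sup \<mu>) (auto intro: \<open>AE z in _. _\<close>)
  define M where "M = Pi\<^sub>M UNIV (\<lambda>n::nat. if n = 0 then \<nu> else \<mu>)"
  define X where "X = (\<lambda>n w. max_path c w n)"
  define Y :: "nat \<Rightarrow> (nat \<Rightarrow> real^'d) \<Rightarrow> real^'d" where "Y = (\<lambda>n w. w n)"
  note model = stationary_max_ar_if_invariant[OF \<mu> \<nu> inv, folded M_def X_def Y_def G_eq]
  have \<nu>_df: "distribution_function (joint_cdf \<nu>)"
    using \<nu> by (auto simp: distribution_function_def)
  interpret max_ar M c "joint_cdf \<nu>" G X Y by (rule model)
  have X: "has_df M (X n) (joint_cdf \<nu>)" for n
    using model(3) by (simp add: X_def)
  have "joint_cdf \<nu> x = joint_cdf \<nu> (scaled c 1 x) * G x" for x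
    using df_X_Suc[of 0 x] c X by (simp add: has_df_def)
  then have "nondegenerate (joint_cdf \<nu>)"
    using summability_condition_iff_nondegenerate[OF \<nu>_df G c] sum by blast
  moreover have "stationary M (\<lambda>n. X (Suc n))"
    using model(2) unfolding X_def .
  ultimately show ?thesis
    using model(1) X unfolding stationary_max_ar_def by blast
qed

theorem proposition2p1:
  fixes c :: "real^'d" and G :: "real^'d \<Rightarrow> real"
  assumes "distribution_function G"
    and "\<And>j. 0 < c $ j \<and> c $ j < 1"
  shows "((\<exists>F0 F (M :: (nat \<Rightarrow> real^'d) measure) X Y. stationary_max_ar M c F0 G X Y F)
            \<longleftrightarrow> summability_condition c G)
       \<and> (\<forall>F0 F (M :: 'a measure) X Y. stationary_max_ar M c F0 G X Y F \<longrightarrow>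
            summability_condition c G \<and> (\<forall>x. F x = F (scaled c 1 x) * G x))"
proof (intro conjI iffI allI impI)
  assume "\<exists>F0 F (M :: (nat \<Rightarrow> real^'d) measure) X Y. stationary_max_ar M c F0 G X Y F"
  then show "summability_condition c G"
    using stationary_max_ar_imp(1)[OF _ assms] by blast
qed (use stationary_max_ar_imp[OF _ assms] ex_stationary_max_ar[OF assms] in blast)+

end
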